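(* Let $n,C\in\mathbb Z_{\ge1}$, $q\in[0,1)^n$, and let $\pi_{\mathsf{EA}}$ be any greedy effective assignment policy. For every $\tau\in\mathbb Z_{\ge1}$, $$V^{\pi_{\mathsf{EA}}}_{\mathsf{EAM}_\tau}\ge\left(1-\Big(1-\frac1\tau\Big)^\tau\right)V^*_{\mathsf{EAM}_\tau}\ge\left(1-\frac1e\right)V^*_{\mathsf{EAM}_\tau}.$$
   Context: Model. An instance has $n\ge1$ threats $[n]=\{1,\dots,n\}$, a per-round capacity $C\in\mathbb Z_{\ge1}$ of effectors, and difficulties $q=(q_i)\in[0,1)^n$, where $q_i$ is the probability that a single effector fails to neutralize threat $i$. Demands $L_1,\dots,L_n$ are independent, $L_i\sim\mathrm{Geom}(1-q_i)$ on $\{1,2,\dots\}$, i.e. $\Pr(L_i>k)=q_i^k$ (with $0^0=1$). $\mathcal M_t\subseteq[n]$ is the set of active threats at the start of round $t$, $\mathcal M_1=[n]$. A policy is $\pi=(\pi_t)_{t\ge1}$, where $\pi_t$ maps each subset $\mathcal M\subseteq[n]$ to a vector $\pi_t(\mathcal M)\in\mathbb Z_{\ge0}^n$ with $\sum_{i\in[n]}[\pi_t(\mathcal M)]_i\le C$ and, for every nonempty $\mathcal M$ and every $t$, $\sum_{i\in\mathcal M}[\pi_t(\mathcal M)]_i=C$; $\Pi$ is the set of all such policies. Under $\pi$, the round-$t$ allocation is $x^t=\pi_t(\mathcal M_t)$ and $\mathcal M_{t+1}=\{i\in\mathcal M_t:\sum_{\ell=1}^t x_i^\ell<L_i\}$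 (equivalently, given $\mathcal M_t$ each $i\in\mathcal M_t$ survives round $t$ independently with probability $q_i^{x_i^t}$). Objective. $V^\pi_{\mathsf{EAM}_\tau}=\mathbb E\big[\sum_{i=1}^n\min\{\sum_{t=1}^\tau x_i^t,L_i\}\big]$ and $V^*_{\mathsf{EAM}_\tau}=\max_{\pi\in\Pi}V^\pi_{\mathsf{EAM}_\tau}$. Greedy effective assignment policy. A policy $\pi\in\Pi$ such that, for every $t$ and every nonempty $\mathcal M$, $\pi_t(\mathcal M)$ is an output of the procedure: start with $x_i=0$ for all $i$; for $k=1,\dots,C$, choose $i^*\in\arg\max_{i\in\mathcal M}q_i^{x_i}$ (ties broken arbitrarily) and increase $x_{i^*}$ by $1$. *)

theory Defs
  imports "HOL-Probability.Probability"
begin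

text \<open>
  Threats are the numbers in \<open>{1..n}\<close> and rounds are \<open>t = 1, 2, \<dots>\<close>.  A vector in
  \<open>\<int>\<^sub>\<ge>\<^sub>0\<^sup>n\<close> is represented by the function \<open>nat \<Rightarrow> nat\<close> that vanishes outside \<open>{1..n}\<close>.
  A policy \<open>\<pi>\<close> maps a round \<open>t\<close> and a set \<open>M\<close> of active threats to such a vector; its values
  at \<open>t = 0\<close> and at sets \<open>M\<close> that are not subsets of \<open>{1..n}\<close> carry no meaning.
\<close>

type_synonym policy = "nat \<Rightarrow> nat set \<Rightarrow> nat \<Rightarrow> nat"

definition policies :: "nat \<Rightarrow> nat \<Rightarrow> policy set" where
  "policies n C = {\<pi>. \<forall>t\<ge>1. \<forall>M\<subseteq>{1..n}.
     (\<forall>i. i \<notin> {1..n} \<longrightarrow> \<pi> t M i = 0) \<and>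
     (\<Sum>i\<in>{1..n}. \<pi> t M i) \<le> C \<and>
     (M \<noteq> {} \<longrightarrow> (\<Sum>i\<in>M. \<pi> t M i) = C)}"

text \<open>
  The library's \<open>geometric_pmf p\<close> counts the failures before the first success, hence lives on
  \<open>{0, 1, \<dots>}\<close>; the shift by \<open>Suc\<close> gives the law on \<open>{1, 2, \<dots>}\<close>.
\<close>

definition demand_pmf :: "nat \<Rightarrow> (nat \<Rightarrow> real) \<Rightarrow> (nat \<Rightarrow> nat) pmf" where
  "demand_pmf n q = Pi_pmf {1..n} 0 (\<lambda>i. map_pmf Suc (geometric_pmf (1 - q i)))"

lemma demand_tail:
  assumes "i \<in> {1..n}" and "0 \<le> q i" and "q i < 1"
  shows "measure_pmf.prob (demand_pmf n q) {L. L i > k} = q i ^ k"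
proof -
  let ?G = "geometric_pmf (1 - q i)"
  have "measure_pmf.prob (demand_pmf n q) {L. L i > k} =
        measure_pmf.prob (map_pmf (\<lambda>L. L i) (demand_pmf n q)) {k<..}"
    by (simp add: vimage_def)
  also have "map_pmf (\<lambda>L. L i) (demand_pmf n q) = map_pmf Suc ?G"
    using assms by (simp add: demand_pmf_def Pi_pmf_component)
  also have "measure_pmf.prob (map_pmf Suc ?G) {k<..} = measure_pmf.prob ?G (UNIV - {..<k})"
    by (auto simp: vimage_def intro!: arg_cong[where f = "measure_pmf.prob ?G"])
  also have "\<dots> = 1 - measure_pmf.prob ?G {..<k}"
    using measure_pmf.prob_compl[of "{..<k}" ?G] by simp
  also have "measure_pmf.prob ?G {..<k} = (\<Sum>j<k. q i ^ j * (1 - q i))"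
    using assms by (simp add: measure_measure_pmf_finite)
  also have "\<dots> = 1 - q i ^ k"
    by (induction k) (simp_all add: algebra_simps)
  finally show ?thesis by simp
qed

text \<open>
  \<open>active n \<pi> L t\<close> is the set of threats active at the start of round \<open>t\<close> when the demands
  are \<open>L\<close>.  Only \<open>t \<ge> 1\<close> is used; the value at \<open>0\<close> is a dummy.
\<close>

fun active :: "nat \<Rightarrow> policy \<Rightarrow> (nat \<Rightarrow> nat) \<Rightarrow> nat \<Rightarrow> nat set" where
  "active n \<pi> L 0 = {1..n}"
| "active n \<pi> L (Suc 0) = {1..n}"
| "active n \<pi> L (Suc (Suc t)) =
     {i \<in> active n \<pi> L (Suc t). (\<Sum>l\<in>{1..Suc t}. \<pi> l (active n \<pi> L l) i) < L i}"

definition alloc :: "nat \<Rightarrow> policy \<Rightarrow> (nat \<Rightarrow> nat) \<Rightarrow> nat \<Rightarrow> nat \<Rightarrow> nat" where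
  "alloc n \<pi> L t = \<pi> t (active n \<pi> L t)"

definition EAM :: "nat \<Rightarrow> (nat \<Rightarrow> real) \<Rightarrow> nat \<Rightarrow> policy \<Rightarrow> real" where
  "EAM n q \<tau> \<pi> = measure_pmf.expectation (demand_pmf n q)
     (\<lambda>L. real (\<Sum>i\<in>{1..n}. min (\<Sum>t\<in>{1..\<tau>}. alloc n \<pi> L t i) (L i)))"

text \<open>
  The maximum is over a finite nonempty set of values (\<open>finite_EAM_values\<close>, \<open>policies_nonempty\<close>), so it is attained.
\<close>

definition EAM_opt :: "nat \<Rightarrow> nat \<Rightarrow> (nat \<Rightarrow> real) \<Rightarrow> nat \<Rightarrow> real" where
  "EAM_opt n C q \<tau> = Max (EAM n q \<tau> ` policies n C)"

lemma policies_nonempty: "policies n C \<noteq> {}"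
proof -
  define \<pi> where
    "\<pi> = (\<lambda>t::nat. \<lambda>M i. if M \<noteq> {} \<and> M \<subseteq> {1..n} \<and> i = Min M then C else 0)"
  have "(\<Sum>i\<in>M. \<pi> t M i) = C" if "M \<subseteq> {1..n}" "M \<noteq> {}" for t M
  proof -
    have "finite M" using that finite_subset by blast
    then show ?thesis using that by (simp add: \<pi>_def)
  qed
  moreover have "(\<Sum>i\<in>{1..n}. \<pi> t M i) \<le> C" for t M
    by (cases "M = {}"; cases "M \<subseteq> {1..n}") (simp_all add: \<pi>_def)
  moreover have "\<pi> t M i = 0" if "M \<subseteq> {1..n}" "i \<notin> {1..n}" for t M i
  proof -
    have "finite M" using that finite_subset by blast
    then have "M \<noteq> {} \<Longrightarrow> Min M \<in> M" by simp
    then have "M \<noteq> {} \<Longrightarrow> i \<noteq> Min M" using that by blast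
    then show ?thesis by (auto simp add: \<pi>_def)
  qed
  ultimately have "\<pi> \<in> policies n C"
    unfolding policies_def mem_Collect_eq by (intro allI impI conjI) assumption+
  then show ?thesis by blast
qed

lemma active_subset: "active n \<pi> L t \<subseteq> {1..n}"
  by (induction n \<pi> L t rule: active.induct) auto

lemma active_cong:
  assumes "\<And>t M i. t \<in> {1..\<tau>} \<Longrightarrow> M \<subseteq> {1..n} \<Longrightarrow> i \<in> {1..n} \<Longrightarrow> \<pi> t M i = \<pi>' t M i"
    and "t \<le> \<tau>"
  shows "active n \<pi> L t = active n \<pi>' L t"
  using assms(2)
proof (induction t rule: less_induct)
  case (less t)
  show ?case
  proof (cases "t \<le> 1")
    case True
    then have "t = 0 \<or> t = Suc 0" by auto
    then show ?thesis by auto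
  next
    case False
    then obtain s where s: "t = Suc (Suc s)"
      by (metis One_nat_def le_Suc_eq le0 not0_implies_Suc)
    have "\<pi> l (active n \<pi> L l) i = \<pi>' l (active n \<pi>' L l) i"
      if "l \<in> {1..Suc s}" "i \<in> {1..n}" for l i
    proof -
      have "active n \<pi> L l = active n \<pi>' L l"
        using less that s by auto
      then show ?thesis
        using assms(1)[of l "active n \<pi> L l" i] that less.prems s active_subset[of n \<pi> L l] by auto
    qed
    then have "(\<Sum>l\<in>{1..Suc s}. \<pi> l (active n \<pi> L l) i) =
        (\<Sum>l\<in>{1..Suc s}. \<pi>' l (active n \<pi>' L l) i)" if "i \<in> {1..n}" for i
      using that by (intro sum.cong) auto
    moreover have "active n \<pi> L (Suc s) = active n \<pi>' L (Suc s)"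
      using less s by auto
    ultimately show ?thesis
      unfolding s active.simps using active_subset[of n \<pi>' L "Suc s"] by auto
  qed
qed

lemma EAM_cong:
  assumes "\<And>t M i. t \<in> {1..\<tau>} \<Longrightarrow> M \<subseteq> {1..n} \<Longrightarrow> i \<in> {1..n} \<Longrightarrow> \<pi> t M i = \<pi>' t M i"
  shows "EAM n q \<tau> \<pi> = EAM n q \<tau> \<pi>'"
proof -
  have "alloc n \<pi> L t i = alloc n \<pi>' L t i" if "t \<in> {1..\<tau>}" "i \<in> {1..n}" for L t i
    unfolding alloc_def
    using active_cong[OF assms, where t = t and L = L] assms[of t "active n \<pi>' L t" i] that
      active_subset[of n \<pi>' L t] by auto
  then have "(\<Sum>i\<in>{1..n}. min (\<Sum>t\<in>{1..\<tau>}. alloc n \<pi> L t i) (L i)) =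
      (\<Sum>i\<in>{1..n}. min (\<Sum>t\<in>{1..\<tau>}. alloc n \<pi>' L t i) (L i))" for L
    by (intro sum.cong refl arg_cong2[where f = min]) auto
  then show ?thesis by (simp add: EAM_def)
qed

lemma finite_EAM_values: "finite (EAM n q \<tau> ` policies n C)"
proof -
  define S :: "policy set" where
    "S = {1..\<tau>} \<rightarrow>\<^sub>E Pow {1..n} \<rightarrow>\<^sub>E {1..n} \<rightarrow>\<^sub>E {0..C}"
  have "finite S"
    unfolding S_def by (intro finite_PiE) auto
  moreover have "EAM n q \<tau> ` policies n C \<subseteq> EAM n q \<tau> ` S"
  proof
    fix v assume "v \<in> EAM n q \<tau> ` policies n C"
    then obtain \<pi> where \<pi>: "\<pi> \<in> policies n C" and v: "v = EAM n q \<tau> \<pi>" by blast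
    define \<rho> where
      "\<rho> = restrict (\<lambda>t. restrict (\<lambda>M. restrict (\<pi> t M) {1..n}) (Pow {1..n})) {1..\<tau>}"
    have "\<pi> t M i \<le> C" if "t \<in> {1..\<tau>}" "M \<subseteq> {1..n}" "i \<in> {1..n}" for t M i
    proof -
      have "\<pi> t M i \<le> (\<Sum>i\<in>{1..n}. \<pi> t M i)"
        using that by (intro member_le_sum) auto
      also have "\<dots> \<le> C" using \<pi> that unfolding policies_def by auto
      finally show ?thesis .
    qed
    then have "\<rho> \<in> S"
      unfolding S_def \<rho>_def by (intro restrict_PiE_iff[THEN iffD2] ballI) auto
    moreover have "v = EAM n q \<tau> \<rho>"
      unfolding v by (rule EAM_cong) (auto simp: \<rho>_def)
    ultimately show "v \<in> EAM n q \<tau> ` S" by blast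
  qed
  ultimately show ?thesis
    by (meson finite_imageI finite_subset)
qed

text \<open>
  \<open>greedy_run q M k x\<close>: the vector \<open>x\<close> can be reached after \<open>k\<close> steps of the greedy procedure
  on the set \<open>M\<close>, for some way of breaking ties.
\<close>

inductive greedy_run :: "(nat \<Rightarrow> real) \<Rightarrow> nat set \<Rightarrow> nat \<Rightarrow> (nat \<Rightarrow> nat) \<Rightarrow> bool"
  for q :: "nat \<Rightarrow> real" and M :: "nat set" where
  start: "greedy_run q M 0 (\<lambda>_. 0)"
| step: "greedy_run q M (Suc k) (x(i := x i + 1))"
    if "greedy_run q M k x" and "is_arg_max (\<lambda>j. q j ^ x j) (\<lambda>j. j \<in> M) i"

definition greedy_EA_policy :: "nat \<Rightarrow> nat \<Rightarrow> (nat \<Rightarrow> real) \<Rightarrow> policy \<Rightarrow> bool" where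
  "greedy_EA_policy n C q \<pi> \<longleftrightarrow> \<pi> \<in> policies n C \<and>
     (\<forall>t\<ge>1. \<forall>M\<subseteq>{1..n}. M \<noteq> {} \<longrightarrow> greedy_run q M C (\<pi> t M))"

end

theory Submission
  imports Defs
begin

text \<open>
  Give threat \<open>i\<close> the weight \<open>1 / (1 - q i)\<close>, its expected demand.  By memorylessness, the expected
  residual demand of an active threat is always its weight, so the expected number of effective
  assignments of a policy equals the expected weight of the threats it has neutralized.  Hence,
  for any policy \<open>\<sigma>\<close> and any set \<open>A\<close>, the value of \<open>\<sigma>\<close> is at most the weight of the complement of
  \<open>A\<close> plus \<open>\<tau>\<close> times the best one-round gain on \<open>A\<close>, which the greedy allocation attains.
  Averaging over the random set \<open>A\<close> left active by the greedy policy after \<open>t\<close> rounds gives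
  \<open>V(\<sigma>) \<le> G t + \<tau> (G (t + 1) - G t)\<close> for the greedy values \<open>G\<close>, so the deficit
  \<open>V(\<sigma>) - G t\<close> shrinks by the factor \<open>1 - 1/\<tau>\<close> in every round.
\<close>

section \<open>Memorylessness and the law of the set of active threats\<close>

definition geometric1_pmf :: "real \<Rightarrow> nat pmf" where
  "geometric1_pmf a = map_pmf Suc (geometric_pmf (1 - a))"

text \<open>Memorylessness in truncated form: \<open>k\<close> effectors leave a fresh copy of the
  demand with probability \<open>a ^ k\<close>; otherwise truncation sends it to 0.\<close>

lemma geometric1_pmf_memoryless:
  assumes a: "0 \<le> a" "a < 1"
  shows "map_pmf (\<lambda>l. l - k) (geometric1_pmf a) =
    bernoulli_pmf (a ^ k) \<bind> (\<lambda>b. if b then geometric1_pmf a else return_pmf 0)"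
proof (rule pmf_eqI)
  fix m :: nat
  let ?G = "geometric_pmf (1 - a)"
  have ak: "0 \<le> a ^ k" "a ^ k \<le> 1" using a by (auto intro: power_le_one)
  have rhs: "pmf (bernoulli_pmf (a ^ k) \<bind> (\<lambda>b. if b then geometric1_pmf a else return_pmf 0)) m
      = a ^ k * pmf (geometric1_pmf a) m + (1 - a ^ k) * indicator {0} m"
    using ak by (simp add: pmf_bind indicator_def)
  have lhs: "pmf (map_pmf (\<lambda>l. l - k) (geometric1_pmf a)) m = measure ?G {j. Suc j - k = m}"
    by (simp add: pmf_map geometric1_pmf_def vimage_def)
  show "pmf (map_pmf (\<lambda>l. l - k) (geometric1_pmf a)) m =
      pmf (bernoulli_pmf (a ^ k) \<bind> (\<lambda>b. if b then geometric1_pmf a else return_pmf 0)) m"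
  \<comment> \<open>Truncation merges all demands up to \<open>k\<close> into 0, while a positive
    remainder has exactly one preimage.\<close>
  proof (cases m)
    case 0
    have "{j. Suc j - k = m} = {..<k}" using 0 by auto
    then have "measure ?G {j. Suc j - k = m} = (\<Sum>j<k. a ^ j * (1 - a))"
      using a by (simp add: measure_measure_pmf_finite)
    also have "\<dots> = 1 - a ^ k" by (induction k) (simp_all add: algebra_simps)
    finally show ?thesis
      using lhs rhs 0 by (simp add: geometric1_pmf_def pmf_map vimage_def)
  next
    case (Suc m')
    have "{j. Suc j - k = m} = {m' + k}" using Suc by auto
    then have "measure ?G {j. Suc j - k = m} = a ^ (m' + k) * (1 - a)"
      using a by (simp add: measure_pmf_single)
    moreover have "pmf (geometric1_pmf a) m = a ^ m' * (1 - a)"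
      using a Suc pmf_map_inj'[of Suc ?G m'] by (simp add: geometric1_pmf_def)
    ultimately show ?thesis using lhs rhs Suc by (simp add: power_add)
  qed
qed

lemma set_geometric1_pmf: "l \<in> set_pmf (geometric1_pmf a) \<Longrightarrow> 0 < l"
  by (auto simp: geometric1_pmf_def)

lemma nn_integral_geometric1_pmf:
  assumes "0 \<le> a" "a < 1"
  shows "(\<integral>\<^sup>+l. ennreal (real l) \<partial>geometric1_pmf a) = ennreal (1 / (1 - a))"
proof -
  have p: "1 - a \<in> {0<..1}" using assms by auto
  have int: "integrable (geometric_pmf (1 - a)) real"
    by (rule integrable_real_geometric_pmf[OF p])
  have "(\<integral>\<^sup>+l. ennreal (real l) \<partial>geometric1_pmf a) =
      (\<integral>\<^sup>+l. ennreal (real (Suc l)) \<partial>geometric_pmf (1 - a))"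
    by (simp add: geometric1_pmf_def)
  also have "\<dots> = ennreal (measure_pmf.expectation (geometric_pmf (1 - a)) (\<lambda>l. real (Suc l)))"
    using int by (intro nn_integral_eq_integral) auto
  also have "measure_pmf.expectation (geometric_pmf (1 - a)) (\<lambda>l. real (Suc l)) = 1 + a / (1 - a)"
    using int expectation_geometric_pmf[OF p] by simp
  also have "1 + a / (1 - a) = 1 / (1 - a)" using assms by (simp add: field_simps)
  finally show ?thesis .
qed

text \<open>The default 0 stands for a neutralized threat; since geometric demands are positive,
  \<open>M\<close> can be read off a sample.\<close>

definition demands_on :: "(nat \<Rightarrow> real) \<Rightarrow> nat set \<Rightarrow> (nat \<Rightarrow> nat) pmf" where
  "demands_on q M = Pi_pmf M 0 (\<lambda>i. geometric1_pmf (q i))"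

text \<open>Transition kernel of the active set for one round with allocation
  \<open>x\<close>.\<close>

definition survivors_pmf :: "(nat \<Rightarrow> real) \<Rightarrow> nat set \<Rightarrow> (nat \<Rightarrow> nat) \<Rightarrow> nat set pmf" where
  "survivors_pmf q M x =
     map_pmf (\<lambda>b. {i \<in> M. b i}) (Pi_pmf M False (\<lambda>i. bernoulli_pmf (q i ^ x i)))"

lemma demands_on_support:
  assumes "finite M" "y \<in> set_pmf (demands_on q M)"
  shows "{i. 0 < y i} = M"
  using assms set_geometric1_pmf
  by (fastforce simp: demands_on_def set_Pi_pmf PiE_dflt_def)

text \<open>Coordinatewise memorylessness, with the product regrouped by \<open>Pi_pmf_bind\<close>:
  first draw who survives, then fresh demands for the survivors.\<close>

lemma demands_on_minus:
  assumes "finite M" and q: "\<And>i. i \<in> M \<Longrightarrow> 0 \<le> q i \<and> q i < 1"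
  shows "map_pmf (\<lambda>y i. y i - x i) (demands_on q M) = survivors_pmf q M x \<bind> demands_on q"
proof -
  have "map_pmf (\<lambda>y i. y i - x i) (demands_on q M) =
      Pi_pmf M 0 (\<lambda>i. geometric1_pmf (q i) \<bind> (\<lambda>l. return_pmf (l - x i)))"
  proof -
    have "Pi_pmf M 0 (\<lambda>i. geometric1_pmf (q i) \<bind> (\<lambda>l. return_pmf (l - x i))) =
        demands_on q M \<bind> (\<lambda>y. Pi_pmf M 0 (\<lambda>i. return_pmf (y i - x i)))"
      unfolding demands_on_def using assms(1) by (rule Pi_pmf_bind)
    also have "\<dots> = demands_on q M \<bind> (\<lambda>y. return_pmf (\<lambda>i. y i - x i))"
    proof (intro bind_pmf_cong refl)
      fix y assume "y \<in> set_pmf (demands_on q M)"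
      \<comment> \<open>Off \<open>M\<close> the demand is 0, and truncated subtraction keeps it 0
        whatever \<open>x\<close> is there.\<close>
      then have "i \<notin> M \<Longrightarrow> y i = 0" for i
        using demands_on_support[OF assms(1), of y q] by (metis (mono_tags) gr0I mem_Collect_eq)
      then have "(\<lambda>i. if i \<in> M then y i - x i else 0) = (\<lambda>i. y i - x i)" by auto
      then show "Pi_pmf M 0 (\<lambda>i. return_pmf (y i - x i)) = return_pmf (\<lambda>i. y i - x i)"
        using assms(1) by (simp add: Pi_pmf_return_pmf)
    qed
    finally show ?thesis by (simp add: map_pmf_def)
  qed
  also have "\<dots> = Pi_pmf M 0 (\<lambda>i. bernoulli_pmf (q i ^ x i) \<bind>
      (\<lambda>b. if b then geometric1_pmf (q i) else return_pmf 0))"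
    using q geometric1_pmf_memoryless
    by (intro Pi_pmf_cong refl) (simp add: map_pmf_def[symmetric])
  also have "\<dots> = Pi_pmf M False (\<lambda>i. bernoulli_pmf (q i ^ x i)) \<bind>
      (\<lambda>b. Pi_pmf M 0 (\<lambda>i. if b i then geometric1_pmf (q i) else return_pmf 0))"
    using assms(1) by (rule Pi_pmf_bind)
  also have "\<dots> = survivors_pmf q M x \<bind> demands_on q"
    using assms(1) by (simp add: survivors_pmf_def bind_map_pmf demands_on_def Pi_pmf_if_set)
  finally show ?thesis .
qed

text \<open>Markov chain of active sets. The index counts completed rounds, so the set drawn at
  \<open>t\<close> meets the policy of round \<open>Suc t\<close>.\<close>

fun state_pmf :: "nat \<Rightarrow> (nat \<Rightarrow> real) \<Rightarrow> policy \<Rightarrow> nat \<Rightarrow> nat set pmf" where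
  "state_pmf n q \<pi> 0 = return_pmf {1..n}"
| "state_pmf n q \<pi> (Suc t) = state_pmf n q \<pi> t \<bind> (\<lambda>M. survivors_pmf q M (\<pi> (Suc t) M))"

text \<open>\<open>residual \<pi> L t\<close> gives the demands left after \<open>t\<close> rounds (so round \<open>t + 1\<close> is about to
  start); truncated subtraction makes its support the set of active threats.\<close>

fun residual :: "policy \<Rightarrow> (nat \<Rightarrow> nat) \<Rightarrow> nat \<Rightarrow> nat \<Rightarrow> nat" where
  "residual \<pi> L 0 = L"
| "residual \<pi> L (Suc t) =
     (\<lambda>i. residual \<pi> L t i - \<pi> (Suc t) {j. 0 < residual \<pi> L t j} i)"

lemma set_state_pmf: "M \<in> set_pmf (state_pmf n q \<pi> t) \<Longrightarrow> M \<subseteq> {1..n}"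
proof (induction t arbitrary: M)
  case (Suc t)
  then obtain N where N: "N \<in> set_pmf (state_pmf n q \<pi> t)"
    and "M \<in> set_pmf (survivors_pmf q N (\<pi> (Suc t) N))"
    by auto
  then have "M \<subseteq> N" by (auto simp: survivors_pmf_def)
  then show ?case using Suc.IH[OF N] by blast
qed simp

lemma finite_set_state_pmf: "finite (set_pmf (state_pmf n q \<pi> t))"
proof (rule finite_subset)
  show "set_pmf (state_pmf n q \<pi> t) \<subseteq> Pow {1..n}" using set_state_pmf by blast
qed simp

text \<open>Given the active set, the remaining demands are independent and fresh, so the past
  leaves no other trace; each round is one use of \<open>demands_on_minus\<close>.\<close>

lemma residual_law:
  assumes q: "\<forall>i\<in>{1..n}. 0 \<le> q i \<and> q i < 1"
  shows "map_pmf (\<lambda>L. residual \<pi> L t) (demand_pmf n q) = state_pmf n q \<pi> t \<bind> demands_on q"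
proof (induction t)
  case 0
  show ?case by (simp add: demand_pmf_def demands_on_def geometric1_pmf_def bind_return_pmf)
next
  case (Suc t)
  let ?step = "\<lambda>y i. y i - \<pi> (Suc t) {j. 0 < y j} i"
  have "map_pmf (\<lambda>L. residual \<pi> L (Suc t)) (demand_pmf n q) =
      map_pmf ?step (map_pmf (\<lambda>L. residual \<pi> L t) (demand_pmf n q))"
    by (simp add: pmf.map_comp o_def)
  also have "\<dots> = state_pmf n q \<pi> t \<bind> (\<lambda>M. map_pmf ?step (demands_on q M))"
    unfolding Suc.IH by (rule map_bind_pmf)
  also have "\<dots> = state_pmf n q \<pi> t \<bind> (\<lambda>M. survivors_pmf q M (\<pi> (Suc t) M) \<bind> demands_on q)"
  proof (intro bind_pmf_cong refl)
    fix M assume "M \<in> set_pmf (state_pmf n q \<pi> t)"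
    then have M: "M \<subseteq> {1..n}" by (rule set_state_pmf)
    then have fin: "finite M" using finite_subset by blast
    \<comment> \<open>Samples of \<open>demands_on q M\<close> have support \<open>M\<close>, so the
      adaptive allocation is a fixed vector here.\<close>
    have "map_pmf ?step (demands_on q M) = map_pmf (\<lambda>y i. y i - \<pi> (Suc t) M i) (demands_on q M)"
      by (intro map_pmf_cong refl) (simp add: demands_on_support[OF fin])
    also have "\<dots> = survivors_pmf q M (\<pi> (Suc t) M) \<bind> demands_on q"
      using fin M q by (intro demands_on_minus) auto
    finally show "map_pmf ?step (demands_on q M) = survivors_pmf q M (\<pi> (Suc t) M) \<bind> demands_on q" .
  qed
  finally show ?case by (simp add: bind_assoc_pmf)
qed

text \<open>Truncated subtractions compose, (L - a) - b = L - (a + b), so the recursion reproduces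
  the cumulative sums in \<open>active\<close>. The hypothesis on \<open>L\<close> holds almost
  surely under \<open>demand_pmf\<close>.\<close>

lemma residual_eq:
  assumes L: "\<And>i. 0 < L i \<longleftrightarrow> i \<in> {1..n}"
  shows "{j. 0 < residual \<pi> L t j} = active n \<pi> L (Suc t) \<and>
    (\<forall>i. residual \<pi> L t i = L i - (\<Sum>l\<in>{1..t}. alloc n \<pi> L l i))"
proof (induction t)
  case 0
  have "{j. 0 < L j} = {1..n}" using L by blast
  then show ?case by simp
next
  case (Suc t)
  then have supp: "{j. 0 < residual \<pi> L t j} = active n \<pi> L (Suc t)"
    and res: "\<And>i. residual \<pi> L t i = L i - (\<Sum>l\<in>{1..t}. alloc n \<pi> L l i)" by blast+
  have res': "residual \<pi> L (Suc t) i = L i - (\<Sum>l\<in>{1..Suc t}. alloc n \<pi> L l i)" for i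
    unfolding residual.simps supp by (simp add: res alloc_def)
  have "active n \<pi> L (Suc (Suc t)) =
      {i \<in> active n \<pi> L (Suc t). (\<Sum>l\<in>{1..Suc t}. alloc n \<pi> L l i) < L i}"
    by (simp add: alloc_def)
  \<comment> \<open>Cumulative allocations only grow, so a demand unmet now was unmet before:
    filtering the previous active set loses nothing.\<close>
  moreover have "i \<in> active n \<pi> L (Suc t)" if "(\<Sum>l\<in>{1..Suc t}. alloc n \<pi> L l i) < L i" for i
  proof -
    have "(\<Sum>l\<in>{1..t}. alloc n \<pi> L l i) < L i" using that by simp
    then have "0 < residual \<pi> L t i" by (simp add: res)
    then show ?thesis using supp by blast
  qed
  ultimately have "active n \<pi> L (Suc (Suc t)) = {i. (\<Sum>l\<in>{1..Suc t}. alloc n \<pi> L l i) < L i}"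
    by blast
  then show ?case unfolding res' by simp
qed

section \<open>Effective assignments as weighted eliminations\<close>

definition survival :: "nat \<Rightarrow> (nat \<Rightarrow> real) \<Rightarrow> policy \<Rightarrow> nat \<Rightarrow> nat \<Rightarrow> real" where
  "survival n q \<pi> t i = measure_pmf.prob (state_pmf n q \<pi> t) {M. i \<in> M}"

text \<open>An active threat carries a fresh demand of mean \<open>1 / (1 - q i)\<close>, any other
  carries 0. The nonnegative integral passes through the bind and then yields integrability and
  value together.\<close>

lemma expectation_residual:
  assumes q: "\<forall>i\<in>{1..n}. 0 \<le> q i \<and> q i < 1" and i: "i \<in> {1..n}"
  shows "integrable (demand_pmf n q) (\<lambda>L. real (residual \<pi> L t i))"
    and "measure_pmf.expectation (demand_pmf n q) (\<lambda>L. real (residual \<pi> L t i)) =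
      survival n q \<pi> t i / (1 - q i)"
proof -
  have *: "(\<integral>\<^sup>+y. ennreal (real (y i)) \<partial>demands_on q M) =
      ennreal (1 / (1 - q i)) * indicator {M. i \<in> M} M"
    if "M \<in> set_pmf (state_pmf n q \<pi> t)" for M
  proof -
    have "finite M" using set_state_pmf[OF that] finite_subset by blast
    then have "map_pmf (\<lambda>y. y i) (demands_on q M) =
        (if i \<in> M then geometric1_pmf (q i) else return_pmf 0)"
      by (simp add: demands_on_def Pi_pmf_component)
    moreover have "(\<integral>\<^sup>+y. ennreal (real (y i)) \<partial>demands_on q M) =
        (\<integral>\<^sup>+l. ennreal (real l) \<partial>map_pmf (\<lambda>y. y i) (demands_on q M))"
      by simp
    ultimately show ?thesis using nn_integral_geometric1_pmf[of "q i"] q i by auto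
  qed
  have "(\<integral>\<^sup>+L. ennreal (real (residual \<pi> L t i)) \<partial>demand_pmf n q) =
      (\<integral>\<^sup>+y. ennreal (real (y i)) \<partial>map_pmf (\<lambda>L. residual \<pi> L t) (demand_pmf n q))"
    by simp
  also have "\<dots> = (\<integral>\<^sup>+M. ennreal (1 / (1 - q i)) * indicator {M. i \<in> M} M \<partial>state_pmf n q \<pi> t)"
    unfolding residual_law[OF q] nn_integral_bind_pmf
    by (intro nn_integral_cong_AE) (auto simp: AE_measure_pmf_iff *)
  also have "\<dots> = ennreal (1 / (1 - q i)) * emeasure (state_pmf n q \<pi> t) {M. i \<in> M}"
    by (simp add: nn_integral_cmult_indicator)
  also have "\<dots> = ennreal (survival n q \<pi> t i / (1 - q i))"
    unfolding measure_pmf.emeasure_eq_measure survival_def[symmetric]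
    using q i by (subst ennreal_mult'[symmetric]) (auto intro: less_imp_le)
  finally have "(\<integral>\<^sup>+L. ennreal (real (residual \<pi> L t i)) \<partial>demand_pmf n q) =
    ennreal (survival n q \<pi> t i / (1 - q i))" .
  moreover have "0 \<le> survival n q \<pi> t i / (1 - q i)"
    using q i by (intro divide_nonneg_nonneg) (auto simp: survival_def intro: less_imp_le)
  ultimately show "integrable (demand_pmf n q) (\<lambda>L. real (residual \<pi> L t i))"
    and "measure_pmf.expectation (demand_pmf n q) (\<lambda>L. real (residual \<pi> L t i)) =
      survival n q \<pi> t i / (1 - q i)"
    by (subst (asm) nn_integral_eq_integrable; simp)+
qed

text \<open>Since min(S, L) = L - (L - S) with truncated inner subtraction, the value is the
  expected drop in total residual demand; initially every survival probability is 1.\<close>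

lemma EAM_eq_weighted_eliminations:
  assumes q: "\<forall>i\<in>{1..n}. 0 \<le> q i \<and> q i < 1"
  shows "EAM n q \<tau> \<pi> = (\<Sum>i\<in>{1..n}. (1 - survival n q \<pi> \<tau> i) / (1 - q i))"
proof -
  have "EAM n q \<tau> \<pi> = measure_pmf.expectation (demand_pmf n q)
      (\<lambda>L. \<Sum>i\<in>{1..n}. real (residual \<pi> L 0 i) - real (residual \<pi> L \<tau> i))"
    unfolding EAM_def
  proof (intro integral_cong_AE)
    show "AE L in demand_pmf n q. real (\<Sum>i\<in>{1..n}. min (\<Sum>t\<in>{1..\<tau>}. alloc n \<pi> L t i) (L i)) =
        (\<Sum>i\<in>{1..n}. real (residual \<pi> L 0 i) - real (residual \<pi> L \<tau> i))"
    proof (unfold AE_measure_pmf_iff, rule ballI)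
      fix L assume "L \<in> set_pmf (demand_pmf n q)"
      then have "{i. 0 < L i} = {1..n}"
        using demands_on_support[of "{1..n}" L q]
        by (simp add: demand_pmf_def demands_on_def geometric1_pmf_def)
      then have "residual \<pi> L \<tau> i = L i - (\<Sum>l\<in>{1..\<tau>}. alloc n \<pi> L l i)" for i
        using residual_eq[of L n \<pi> \<tau>] by blast
      then show "real (\<Sum>i\<in>{1..n}. min (\<Sum>t\<in>{1..\<tau>}. alloc n \<pi> L t i) (L i)) =
          (\<Sum>i\<in>{1..n}. real (residual \<pi> L 0 i) - real (residual \<pi> L \<tau> i))"
        by (auto intro!: sum.cong)
    qed
  qed simp_all
  also have "\<dots> = (\<Sum>i\<in>{1..n}. survival n q \<pi> 0 i / (1 - q i) - survival n q \<pi> \<tau> i / (1 - q i))"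
  proof -
    have "measure_pmf.expectation (demand_pmf n q)
        (\<lambda>L. \<Sum>i\<in>{1..n}. real (residual \<pi> L 0 i) - real (residual \<pi> L \<tau> i)) =
      (\<Sum>i\<in>{1..n}. measure_pmf.expectation (demand_pmf n q)
        (\<lambda>L. real (residual \<pi> L 0 i) - real (residual \<pi> L \<tau> i)))"
      by (rule Bochner_Integration.integral_sum)
        (intro Bochner_Integration.integrable_diff expectation_residual(1)[OF q])
    also have "\<dots> = (\<Sum>i\<in>{1..n}. survival n q \<pi> 0 i / (1 - q i) - survival n q \<pi> \<tau> i / (1 - q i))"
      by (intro sum.cong refl)
        (simp only: Bochner_Integration.integral_diff expectation_residual[OF q])
    finally show ?thesis .
  qed
  also have "\<dots> = (\<Sum>i\<in>{1..n}. (1 - survival n q \<pi> \<tau> i) / (1 - q i))"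
    by (intro sum.cong refl) (simp add: survival_def diff_divide_distrib)
  finally show ?thesis .
qed

lemma survival_nonneg: "0 \<le> survival n q \<pi> t i"
  by (simp add: survival_def)

section \<open>One-round drop of the survival probabilities\<close>

lemma prob_survivors:
  assumes "finite M" and q: "\<And>i. i \<in> M \<Longrightarrow> 0 \<le> q i \<and> q i < 1"
  shows "measure_pmf.prob (survivors_pmf q M x) {N. i \<in> N} = (if i \<in> M then q i ^ x i else 0)"
proof (cases "i \<in> M")
  case True
  then have "q i ^ x i \<le> 1" "0 \<le> q i ^ x i" using q by (auto intro: power_le_one less_imp_le)
  have "measure_pmf.prob (survivors_pmf q M x) {N. i \<in> N} =
      measure_pmf.prob (map_pmf (\<lambda>b. b i) (Pi_pmf M False (\<lambda>i. bernoulli_pmf (q i ^ x i)))) {True}"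
    using True by (simp add: survivors_pmf_def vimage_def)
  also have "\<dots> = q i ^ x i"
    using True assms(1) \<open>q i ^ x i \<le> 1\<close> \<open>0 \<le> q i ^ x i\<close>
    by (simp add: Pi_pmf_component measure_pmf_single)
  finally show ?thesis using True by simp
qed (simp add: survivors_pmf_def vimage_def)

text \<open>For a set \<open>A\<close> of active threats, memorylessness makes this the expected number of effective assignments to
  \<open>A\<close> in one round with allocation \<open>x\<close>.\<close>

definition gain :: "(nat \<Rightarrow> real) \<Rightarrow> nat set \<Rightarrow> (nat \<Rightarrow> nat) \<Rightarrow> real" where
  "gain q A x = (\<Sum>i\<in>A. (1 - q i ^ x i) / (1 - q i))"

lemma gain_term_nonneg:
  assumes "0 \<le> q i \<and> q i < (1::real)"
  shows "0 \<le> (1 - q i ^ k) / (1 - q i)"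
  using assms by (simp add: power_le_one)

lemma survival_Suc:
  assumes q: "\<forall>i\<in>{1..n}. 0 \<le> q i \<and> q i < 1"
  shows "survival n q \<pi> t i - survival n q \<pi> (Suc t) i =
    measure_pmf.expectation (state_pmf n q \<pi> t)
      (\<lambda>M. if i \<in> M then 1 - q i ^ \<pi> (Suc t) M i else 0)"
proof -
  let ?S = "state_pmf n q \<pi> t"
  have int: "integrable ?S f" for f :: "nat set \<Rightarrow> real"
    by (rule integrable_measure_pmf_finite[OF finite_set_state_pmf])
  have "survival n q \<pi> (Suc t) i = measure_pmf.expectation ?S
      (\<lambda>M. measure_pmf.prob (survivors_pmf q M (\<pi> (Suc t) M)) {N. i \<in> N})"
  proof -
    \<comment> \<open>Seen as the mass of \<open>True\<close> for a Boolean variable, the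
      probability can be conditioned on the previous active set by \<open>pmf_bind\<close>.\<close>
    have "survival n q \<pi> (Suc t) i =
        pmf (map_pmf (\<lambda>M. i \<in> M) (state_pmf n q \<pi> (Suc t))) True"
      by (simp add: survival_def pmf_map vimage_def)
    then show ?thesis by (simp add: map_bind_pmf pmf_bind pmf_map vimage_def)
  qed
  also have "\<dots> = measure_pmf.expectation ?S (\<lambda>M. if i \<in> M then q i ^ \<pi> (Suc t) M i else 0)"
  proof (intro integral_cong_AE)
    have "measure_pmf.prob (survivors_pmf q M (\<pi> (Suc t) M)) {N. i \<in> N} =
        (if i \<in> M then q i ^ \<pi> (Suc t) M i else 0)" if "M \<in> set_pmf ?S" for M
    proof (rule prob_survivors)
      show "finite M" using set_state_pmf[OF that] finite_subset by blast
    qed (use set_state_pmf[OF that] q in blast)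
    then show "AE M in ?S. measure_pmf.prob (survivors_pmf q M (\<pi> (Suc t) M)) {N. i \<in> N} =
        (if i \<in> M then q i ^ \<pi> (Suc t) M i else 0)"
      by (simp add: AE_measure_pmf_iff)
  qed simp_all
  finally have "survival n q \<pi> (Suc t) i =
    measure_pmf.expectation ?S (\<lambda>M. if i \<in> M then q i ^ \<pi> (Suc t) M i else 0)" .
  moreover have "survival n q \<pi> t i = measure_pmf.expectation ?S (indicator {M. i \<in> M})"
    by (simp add: survival_def)
  ultimately have "survival n q \<pi> t i - survival n q \<pi> (Suc t) i = measure_pmf.expectation ?S
      (\<lambda>M. indicator {M. i \<in> M} M - (if i \<in> M then q i ^ \<pi> (Suc t) M i else 0))"
    by (simp only: Bochner_Integration.integral_diff[OF int int])
  also have "\<dots> = measure_pmf.expectation ?S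
      (\<lambda>M. if i \<in> M then 1 - q i ^ \<pi> (Suc t) M i else 0)"
    by (intro Bochner_Integration.integral_cong) (auto simp: indicator_def)
  finally show ?thesis .
qed

text \<open>\<open>A\<close> is fixed while the policy acts on the whole active set.
  \<open>A = {1..n}\<close> gives the increments of \<open>EAM\<close>; a general \<open>A\<close>
  serves to bound a competing policy.\<close>

lemma weighted_survival_Suc:
  assumes q: "\<forall>i\<in>{1..n}. 0 \<le> q i \<and> q i < 1" and A: "A \<subseteq> {1..n}"
  shows "(\<Sum>i\<in>A. (survival n q \<pi> t i - survival n q \<pi> (Suc t) i) / (1 - q i)) =
    measure_pmf.expectation (state_pmf n q \<pi> t) (\<lambda>M. gain q (A \<inter> M) (\<pi> (Suc t) M))"
proof -
  let ?S = "state_pmf n q \<pi> t"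
  have int: "integrable ?S f" for f :: "nat set \<Rightarrow> real"
    by (rule integrable_measure_pmf_finite[OF finite_set_state_pmf])
  have "finite A" using A finite_subset by blast
  have "(\<Sum>i\<in>A. (survival n q \<pi> t i - survival n q \<pi> (Suc t) i) / (1 - q i)) =
      measure_pmf.expectation ?S
        (\<lambda>M. \<Sum>i\<in>A. (if i \<in> M then 1 - q i ^ \<pi> (Suc t) M i else 0) / (1 - q i))"
    by (simp add: survival_Suc[OF q] Bochner_Integration.integral_sum[OF int])
  also have "(\<lambda>M. \<Sum>i\<in>A. (if i \<in> M then 1 - q i ^ \<pi> (Suc t) M i else 0) / (1 - q i)) =
      (\<lambda>M. gain q (A \<inter> M) (\<pi> (Suc t) M))"
    unfolding gain_def sum.inter_restrict[OF \<open>finite A\<close>] by (auto intro!: ext sum.cong)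
  finally show ?thesis .
qed

section \<open>One-round optimality of the greedy allocation\<close>

text \<open>The last unit given to \<open>i\<close> had maximal marginal value when it was placed,
  and marginal values only decrease afterwards.\<close>

lemma greedy_run_invariant:
  assumes "greedy_run q M k x" and "finite M" and q: "\<And>i. i \<in> M \<Longrightarrow> 0 \<le> q i \<and> q i < 1"
  shows "(\<Sum>i\<in>M. x i) = k \<and> (\<forall>i\<in>M. \<forall>j\<in>M. 0 < x i \<longrightarrow> q j ^ x j \<le> q i ^ (x i - 1))"
  using assms(1)
proof induction
  case start
  then show ?case by simp
next
  case (step k x i)
  let ?x = "x(i := x i + 1)"
  have i: "i \<in> M" and max: "\<And>j. j \<in> M \<Longrightarrow> q j ^ x j \<le> q i ^ x i"
    using step.hyps(2) by (auto simp: is_arg_max_linorder)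
  have "(\<Sum>j\<in>M. ?x j) = ?x i + (\<Sum>j\<in>M - {i}. ?x j)"
    using assms(2) i by (rule sum.remove)
  also have "(\<Sum>j\<in>M - {i}. ?x j) = (\<Sum>j\<in>M - {i}. x j)" by (intro sum.cong) auto
  also have "?x i + (\<Sum>j\<in>M - {i}. x j) = Suc (\<Sum>j\<in>M. x j)"
    using assms(2) i by (simp add: sum.remove)
  finally have sum: "(\<Sum>j\<in>M. ?x j) = Suc k" using step.IH by simp
  have le: "q j ^ ?x j \<le> q j ^ x j" if "j \<in> M" for j
    using q[OF that] by (auto intro!: mult_left_le_one_le)
  have "q j ^ ?x j \<le> q m ^ (?x m - 1)" if "m \<in> M" "j \<in> M" "0 < ?x m" for m j
  proof (cases "m = i")
    case True
    then show ?thesis using le[of j] max[of j] that by simp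
  next
    case False
    then have "q j ^ x j \<le> q m ^ (x m - 1)" using that step.IH by auto
    then show ?thesis using le[of j] that False by simp
  qed
  then show ?case using sum by blast
qed

text \<open>By concavity, \<open>c\<close> (the largest marginal value left by the greedy run) is the slope of a supporting line of
  \<open>k \<mapsto> (1 - a ^ k) / (1 - a)\<close> at \<open>k = x\<close>.\<close>

lemma geometric_sum_tangent:
  fixes a c :: real
  assumes a: "0 \<le> a" "a < 1" and up: "a ^ x \<le> c" and down: "0 < x \<Longrightarrow> c \<le> a ^ (x - 1)"
  shows "(1 - a ^ y) / (1 - a) - (1 - a ^ x) / (1 - a) \<le> c * (real y - real x)"
proof -
  \<comment> \<open>The value is a sum of marginals \<open>a ^ j\<close>, nonincreasing in
    \<open>j\<close>: those from \<open>x\<close> on are at most \<open>c\<close>, those before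
    \<open>x\<close> at least \<open>c\<close>.\<close>
  have geo: "(1 - a ^ k) / (1 - a) = (\<Sum>j<k. a ^ j)" for k
    using a sum_gp_strict[of a k] by simp
  show ?thesis
  proof (cases "x \<le> y")
    case True
    have "(\<Sum>j<y. a ^ j) = (\<Sum>j<x. a ^ j) + (\<Sum>j=x..<y. a ^ j)"
      using True by (metis atLeast0LessThan le0 sum.atLeastLessThan_concat)
    moreover have "(\<Sum>j=x..<y. a ^ j) \<le> real (card {x..<y}) * c"
    proof (rule sum_bounded_above)
      fix j assume "j \<in> {x..<y}"
      then have "a ^ j \<le> a ^ x" using a by (intro power_decreasing) auto
      then show "a ^ j \<le> c" using up by linarith
    qed
    ultimately show ?thesis using True by (simp add: geo of_nat_diff algebra_simps)
  next
    case False
    have "(\<Sum>j<x. a ^ j) = (\<Sum>j<y. a ^ j) + (\<Sum>j=y..<x. a ^ j)"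
      using False by (metis atLeast0LessThan le0 nat_le_linear sum.atLeastLessThan_concat)
    moreover have "real (card {y..<x}) * c \<le> (\<Sum>j=y..<x. a ^ j)"
    proof (rule sum_bounded_below)
      fix j assume "j \<in> {y..<x}"
      then have "a ^ (x - 1) \<le> a ^ j" "0 < x" using a by (auto intro: power_decreasing)
      then show "c \<le> a ^ j" using down by linarith
    qed
    ultimately show ?thesis using False by (simp add: geo of_nat_diff algebra_simps)
  qed
qed

text \<open>\<open>c\<close> acts as a Lagrange multiplier, a common price per effector: summing the
  tangent bounds over \<open>M\<close> leaves \<open>c\<close> times the difference of the two
  budgets.\<close>

lemma greedy_run_optimal:
  assumes run: "greedy_run q M C x" and M: "finite M" and q: "\<And>i. i \<in> M \<Longrightarrow> 0 \<le> q i \<and> q i < 1"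
    and y: "(\<Sum>i\<in>M. y i) \<le> C"
  shows "gain q M y \<le> gain q M x"
proof (cases "M = {}")
  case False
  define c where "c = Max ((\<lambda>j. q j ^ x j) ` M)"
  have up: "q i ^ x i \<le> c" if "i \<in> M" for i
    using that M by (simp add: c_def)
  have inv: "(\<Sum>i\<in>M. x i) = C" "\<forall>i\<in>M. \<forall>j\<in>M. 0 < x i \<longrightarrow> q j ^ x j \<le> q i ^ (x i - 1)"
    using greedy_run_invariant[OF run M q] by auto
  have down: "c \<le> q i ^ (x i - 1)" if "i \<in> M" "0 < x i" for i
    using inv(2) that M False by (simp add: c_def)
  \<comment> \<open>The sign matters because \<open>y\<close> may spend less than \<open>C\<close>
    on \<open>M\<close>.\<close>
  have "0 \<le> c"
  proof -
    obtain i where "i \<in> M" using False by blast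
    then show ?thesis using up[of i] q[of i] by (meson order_trans zero_le_power)
  qed
  have "gain q M y - gain q M x \<le> (\<Sum>i\<in>M. c * (real (y i) - real (x i)))"
    unfolding gain_def sum_subtractf[symmetric]
    using q up down by (intro sum_mono geometric_sum_tangent) auto
  also have "\<dots> = c * (real (\<Sum>i\<in>M. y i) - real (\<Sum>i\<in>M. x i))"
    by (simp add: sum_distrib_left[symmetric] sum_subtractf)
  also have "\<dots> \<le> 0"
    using y inv(1) \<open>0 \<le> c\<close> by (intro mult_nonneg_nonpos) (auto simp del: of_nat_sum)
  finally show ?thesis by simp
qed (simp add: gain_def)

section \<open>The approximation guarantee\<close>

text \<open>Treating all of \<open>A\<close> as active only adds nonnegative terms, and what
  \<open>\<sigma>\<close> spends inside \<open>A\<close> fits the budget of the greedy run on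
  \<open>A\<close>.\<close>

lemma greedy_gain_ge:
  assumes q: "\<forall>i\<in>{1..n}. 0 \<le> q i \<and> q i < 1" and greedy: "greedy_EA_policy n C q \<pi>"
    and \<sigma>: "\<sigma> \<in> policies n C" and st: "1 \<le> s" "1 \<le> t"
    and M: "M \<subseteq> {1..n}" and A: "A \<subseteq> {1..n}"
  shows "gain q (A \<inter> M) (\<sigma> s M) \<le> gain q A (\<pi> t A)"
proof (cases "A = {}")
  case False
  have fin: "finite A" using A finite_subset by blast
  have "gain q (A \<inter> M) (\<sigma> s M) \<le> gain q A (\<sigma> s M)"
    unfolding gain_def using fin A q by (intro sum_mono2 gain_term_nonneg) auto
  also have "\<dots> \<le> gain q A (\<pi> t A)"
  proof (rule greedy_run_optimal)
    show "greedy_run q A C (\<pi> t A)"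
      using greedy st A False by (simp add: greedy_EA_policy_def)
    have "(\<Sum>i\<in>A. \<sigma> s M i) \<le> (\<Sum>i\<in>{1..n}. \<sigma> s M i)"
      using A by (intro sum_mono2) auto
    also have "\<dots> \<le> C" using \<sigma> st M by (simp add: policies_def)
    finally show "(\<Sum>i\<in>A. \<sigma> s M i) \<le> C" .
  qed (use fin A q in auto)
  finally show ?thesis .
qed (simp add: gain_def)

text \<open>Threats outside \<open>A\<close> contribute at most their full weight to \<open>\<sigma>\<close>, and in each
  round those in \<open>A\<close> contribute at most a greedy round on \<open>A\<close>.\<close>

lemma EAM_le_removed_plus_gain:
  assumes q: "\<forall>i\<in>{1..n}. 0 \<le> q i \<and> q i < 1" and greedy: "greedy_EA_policy n C q \<pi>"
    and \<sigma>: "\<sigma> \<in> policies n C" and t: "1 \<le> t" and A: "A \<subseteq> {1..n}"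
  shows "EAM n q \<tau> \<sigma> \<le> (\<Sum>i\<in>{1..n} - A. 1 / (1 - q i)) + real \<tau> * gain q A (\<pi> t A)"
proof -
  let ?s = "survival n q \<sigma>"
  have "(\<Sum>i\<in>A. (1 - ?s \<tau> i) / (1 - q i)) \<le> real \<tau> * gain q A (\<pi> t A)"
  proof (induction \<tau>)
    case 0
    have "?s 0 i = 1" if "i \<in> A" for i using that A by (auto simp: survival_def)
    then show ?case by simp
  next
    case (Suc k)
    have "(\<Sum>i\<in>A. (?s k i - ?s (Suc k) i) / (1 - q i)) =
        measure_pmf.expectation (state_pmf n q \<sigma> k) (\<lambda>M. gain q (A \<inter> M) (\<sigma> (Suc k) M))"
      by (rule weighted_survival_Suc[OF q A])
    \<comment> \<open>The bound is uniform in the state \<open>M\<close> of \<open>\<sigma>\<close>,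
      so its law is irrelevant.\<close>
    also have "\<dots> \<le> measure_pmf.expectation (state_pmf n q \<sigma> k) (\<lambda>_. gain q A (\<pi> t A))"
      using greedy_gain_ge[OF q greedy \<sigma> _ t _ A] set_state_pmf
      by (intro integral_mono_AE integrable_measure_pmf_finite finite_set_state_pmf)
        (auto simp: AE_measure_pmf_iff)
    finally have "(\<Sum>i\<in>A. (?s k i - ?s (Suc k) i) / (1 - q i)) \<le> gain q A (\<pi> t A)" by simp
    moreover have "(\<Sum>i\<in>A. (1 - ?s (Suc k) i) / (1 - q i)) =
        (\<Sum>i\<in>A. (1 - ?s k i) / (1 - q i)) + (\<Sum>i\<in>A. (?s k i - ?s (Suc k) i) / (1 - q i))"
      by (simp add: sum.distrib[symmetric] add_divide_distrib[symmetric])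
    ultimately show ?case using Suc.IH by (simp add: algebra_simps)
  qed
  moreover have "(\<Sum>i\<in>{1..n} - A. (1 - ?s \<tau> i) / (1 - q i)) \<le> (\<Sum>i\<in>{1..n} - A. 1 / (1 - q i))"
    using q survival_nonneg[of n q \<sigma> \<tau>] by (intro sum_mono divide_right_mono) (auto intro: less_imp_le)
  moreover have "EAM n q \<tau> \<sigma> = (\<Sum>i\<in>{1..n} - A. (1 - ?s \<tau> i) / (1 - q i)) +
      (\<Sum>i\<in>A. (1 - ?s \<tau> i) / (1 - q i))"
    unfolding EAM_eq_weighted_eliminations[OF q] using A by (intro sum.subset_diff) auto
  ultimately show ?thesis by linarith
qed

text \<open>Average \<open>EAM_le_removed_plus_gain\<close> over the set \<open>A\<close> that
  \<open>\<pi>\<close> leaves active after \<open>t\<close> rounds.\<close>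

lemma greedy_progress:
  assumes q: "\<forall>i\<in>{1..n}. 0 \<le> q i \<and> q i < 1" and greedy: "greedy_EA_policy n C q \<pi>"
    and \<sigma>: "\<sigma> \<in> policies n C"
  shows "EAM n q \<tau> \<sigma> \<le> EAM n q t \<pi> + real \<tau> * (EAM n q (Suc t) \<pi> - EAM n q t \<pi>)"
proof -
  let ?S = "state_pmf n q \<pi> t" and ?s = "survival n q \<pi>"
  have int: "integrable ?S f" for f :: "nat set \<Rightarrow> real"
    by (rule integrable_measure_pmf_finite[OF finite_set_state_pmf])
  have "EAM n q \<tau> \<sigma> = measure_pmf.expectation ?S (\<lambda>_. EAM n q \<tau> \<sigma>)" by simp
  \<comment> \<open>The intersection with \<open>{1..n}\<close> changes nothing on the support; it
    matches the form of \<open>weighted_survival_Suc\<close>.\<close>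
  also have "\<dots> \<le> measure_pmf.expectation ?S (\<lambda>A. (\<Sum>i\<in>{1..n} - A. 1 / (1 - q i)) +
      real \<tau> * gain q ({1..n} \<inter> A) (\<pi> (Suc t) A))"
  proof (intro integral_mono_AE int, unfold AE_measure_pmf_iff, rule ballI)
    fix A assume "A \<in> set_pmf ?S"
    then have A: "A \<subseteq> {1..n}" by (rule set_state_pmf)
    then have "{1..n} \<inter> A = A" by blast
    then show "EAM n q \<tau> \<sigma> \<le> (\<Sum>i\<in>{1..n} - A. 1 / (1 - q i)) +
        real \<tau> * gain q ({1..n} \<inter> A) (\<pi> (Suc t) A)"
      using EAM_le_removed_plus_gain[OF q greedy \<sigma> _ A, of "Suc t" \<tau>] by simp
  qed
  also have "\<dots> = measure_pmf.expectation ?S (\<lambda>A. \<Sum>i\<in>{1..n} - A. 1 / (1 - q i)) +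
      real \<tau> * measure_pmf.expectation ?S (\<lambda>A. gain q ({1..n} \<inter> A) (\<pi> (Suc t) A))"
    by (simp add: Bochner_Integration.integral_add[OF int int])
  \<comment> \<open>Threat \<open>i\<close> is missing from \<open>A\<close> with probability
    \<open>1 - survival n q \<pi> t i\<close>, so the removed weight averages to the value of
    \<open>\<pi>\<close>.\<close>
  also have "measure_pmf.expectation ?S (\<lambda>A. \<Sum>i\<in>{1..n} - A. 1 / (1 - q i)) = EAM n q t \<pi>"
  proof -
    have "(\<Sum>i\<in>{1..n} - A. 1 / (1 - q i)) =
        (\<Sum>i\<in>{1..n}. (1 - indicator {A. i \<in> A} A) / (1 - q i))" for A
      by (rule sum.mono_neutral_cong_left) (auto simp: indicator_def)
    then have "measure_pmf.expectation ?S (\<lambda>A. \<Sum>i\<in>{1..n} - A. 1 / (1 - q i)) =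
        (\<Sum>i\<in>{1..n}. measure_pmf.expectation ?S (\<lambda>A. 1 - indicator {A. i \<in> A} A) / (1 - q i))"
      by (simp add: Bochner_Integration.integral_sum[OF int])
    also have "\<dots> = EAM n q t \<pi>"
      unfolding EAM_eq_weighted_eliminations[OF q]
      by (simp add: Bochner_Integration.integral_diff[OF int int] survival_def)
    finally show ?thesis .
  qed
  also have "measure_pmf.expectation ?S (\<lambda>A. gain q ({1..n} \<inter> A) (\<pi> (Suc t) A)) =
      EAM n q (Suc t) \<pi> - EAM n q t \<pi>"
    unfolding EAM_eq_weighted_eliminations[OF q] sum_subtractf[symmetric]
      weighted_survival_Suc[OF q order_refl, symmetric]
    by (intro sum.cong refl) (simp add: diff_divide_distrib)
  finally show ?thesis .
qed

section \<open>Contraction of the deficit\<close>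

lemma EAM_0: "EAM n q 0 \<pi> = 0"
  by (simp add: EAM_def)

lemma EAM_nonneg: "0 \<le> EAM n q \<tau> \<pi>"
  unfolding EAM_def by (intro Bochner_Integration.integral_nonneg of_nat_0_le_iff)

text \<open>The horizon \<open>\<tau>\<close> of \<open>\<sigma>\<close> stays fixed while
  \<open>\<pi>\<close> runs for \<open>t\<close> rounds; \<open>greedy_progress\<close> says each
  round closes at least a fraction \<open>1 / \<tau>\<close> of the gap.\<close>

lemma greedy_deficit:
  assumes q: "\<forall>i\<in>{1..n}. 0 \<le> q i \<and> q i < 1" and greedy: "greedy_EA_policy n C q \<pi>"
    and \<sigma>: "\<sigma> \<in> policies n C" and \<tau>: "1 \<le> \<tau>"
  shows "EAM n q \<tau> \<sigma> - EAM n q t \<pi> \<le> (1 - 1 / real \<tau>) ^ t * EAM n q \<tau> \<sigma>"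
proof (induction t)
  case 0
  then show ?case by (simp add: EAM_0)
next
  case (Suc t)
  let ?V = "EAM n q \<tau> \<sigma>" and ?G = "\<lambda>t. EAM n q t \<pi>"
  have "(?V - ?G t) / real \<tau> \<le> ?G (Suc t) - ?G t"
    using greedy_progress[OF q greedy \<sigma>, of \<tau> t] \<tau> by (simp add: divide_le_eq mult.commute)
  then have "?V - ?G (Suc t) \<le> (1 - 1 / real \<tau>) * (?V - ?G t)"
    by (simp add: left_diff_distrib)
  \<comment> \<open>The factor is nonnegative because \<open>\<tau>\<close> is at least 1.\<close>
  also have "\<dots> \<le> (1 - 1 / real \<tau>) * ((1 - 1 / real \<tau>) ^ t * ?V)"
    using Suc.IH \<tau> by (intro mult_left_mono) auto
  finally show ?case by (simp add: mult.assoc)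
qed

theorem theorem9:
  fixes n C :: nat and q :: "nat \<Rightarrow> real" and \<pi> :: policy and \<tau> :: nat
  assumes "n \<ge> 1" and "C \<ge> 1"
    and "\<forall>i\<in>{1..n}. 0 \<le> q i \<and> q i < 1"
    and "greedy_EA_policy n C q \<pi>"
    and "\<tau> \<ge> 1"
  shows "EAM n q \<tau> \<pi> \<ge> (1 - (1 - 1 / real \<tau>) ^ \<tau>) * EAM_opt n C q \<tau> \<and>
         (1 - (1 - 1 / real \<tau>) ^ \<tau>) * EAM_opt n C q \<tau> \<ge> (1 - 1 / exp 1) * EAM_opt n C q \<tau>"
proof
  have "EAM_opt n C q \<tau> \<in> EAM n q \<tau> ` policies n C"
    unfolding EAM_opt_def by (intro Max_in finite_EAM_values) (simp add: policies_nonempty)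
  then obtain \<sigma> where \<sigma>: "\<sigma> \<in> policies n C" and opt: "EAM_opt n C q \<tau> = EAM n q \<tau> \<sigma>" by blast
  \<comment> \<open>Let the greedy policy run for \<open>t = \<tau>\<close> rounds against an
    optimal \<open>\<sigma>\<close>.\<close>
  show "EAM n q \<tau> \<pi> \<ge> (1 - (1 - 1 / real \<tau>) ^ \<tau>) * EAM_opt n C q \<tau>"
    using greedy_deficit[OF assms(3,4) \<sigma> assms(5), of \<tau>] by (simp add: opt left_diff_distrib)
  have "(1 - 1 / real \<tau>) ^ \<tau> \<le> exp (- 1)"
    using exp_ge_one_minus_x_over_n_power_n[of 1 \<tau>] assms(5) by simp
  then show "(1 - 1 / exp 1) * EAM_opt n C q \<tau> \<le> (1 - (1 - 1 / real \<tau>) ^ \<tau>) * EAM_opt n C q \<tau>"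
    unfolding opt by (intro mult_right_mono EAM_nonneg) (simp add: exp_minus inverse_eq_divide)
qed

end
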